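(* Let $(\mathbb{F},+,\cdot)$ be a field. If the functions $f,\alpha\colon\mathbb{F}\to\mathbb{F}$ satisfy \[ f(x+y)-f(x)-f(y)=\alpha(xy)\qquad\text{for all } x,y\in\mathbb{F}, \] then there exist a constant $\gamma\in\mathbb{F}$ and additive functions $a,A\colon\mathbb{F}\to\mathbb{F}$ (i.e. $a(x+y)=a(x)+a(y)$ and $A(x+y)=A(x)+A(y)$ for all $x,y\in\mathbb{F}$) such that \[ \alpha(x)=a(x)+\gamma\qquad\text{and}\qquad f(x)=\tfrac12 a(x^{2})+A(x)+\gamma \] hold for all $x\in\mathbb{F}$.
   Formalization: The constant in the formula for f is −γ instead of the printed +γ (f = 1, α = −1 over the reals refutes the printed sign), and the field is assumed to satisfy 2 ≠ 0 so that 1/2 is defined. *)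

theory Defs
  imports Complex_Main
begin

end

theory Submission
  imports Defs
begin

text \<open>
  After subtracting constants, assume \<open>f 0 = \<alpha> 0 = 0\<close>. Comparing the two expansions of
  \<open>f (x + y + z)\<close> for \<open>z = - y\<close> shows that \<open>\<alpha>\<close> is additive on pairs whose sum is the negative
  of a square. In characteristic other than 2 every element is a difference of two squares, which
  first yields that \<open>\<alpha>\<close> is odd, then that \<open>\<alpha> (s\<^sup>2 + m) = \<alpha> (s\<^sup>2) + \<alpha> m\<close>, and then
  additivity.
\<close>

lemma square_diff_representation:
  fixes k :: "'a::field"
  assumes "(2::'a) \<noteq> 0"
  shows "((k + 1) / 2)\<^sup>2 - ((k - 1) / 2)\<^sup>2 = k"
proof -
  have "((k + 1) / 2)\<^sup>2 - ((k - 1) / 2)\<^sup>2 = ((k + 1) / 2 + (k - 1) / 2) * ((k + 1) / 2 - (k - 1) / 2)"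
    by (simp add: power2_eq_square algebra_simps)
  moreover have "(k + 1) / 2 + (k - 1) / 2 = k" "(k + 1) / 2 - (k - 1) / 2 = 1"
    using assms by (simp_all add: add_divide_distrib[symmetric] diff_divide_distrib[symmetric])
  ultimately show ?thesis by simp
qed

text \<open>The final theorem instantiates this with shifted functions, so \<open>\<alpha>\<close>
  here stands for the original one minus its value at 0.\<close>

locale normalized_solution =
  fixes g \<alpha> :: "'a::field \<Rightarrow> 'a"
  assumes two_nonzero: "(2::'a) \<noteq> 0"
    and g_add: "g (x + y) = g x + g y + \<alpha> (x * y)"
    and g_zero: "g 0 = 0"
begin

lemma alpha_zero: "\<alpha> 0 = 0"
  using g_add[of 0 0] g_zero by simp

lemma alpha_add_neg_square: "\<alpha> m + \<alpha> (- y\<^sup>2 - m) = \<alpha> (- y\<^sup>2)" if "y \<noteq> 0"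
proof -
  \<comment> \<open>Dividing by \<open>y\<close> makes an arbitrary \<open>m\<close> a product
    \<open>x * y\<close>; then \<open>g x\<close> is expanded as
    \<open>g ((x + y) + (- y))\<close>.\<close>
  define x where "x = m / y"
  have m: "x * y = m" using that by (simp add: x_def)
  have "(x + y) * - y = - y\<^sup>2 - m" "y * - y = - y\<^sup>2"
    using m by (simp_all add: algebra_simps power2_eq_square)
  then have "g x = g (x + y) + g (- y) + \<alpha> (- y\<^sup>2 - m)" "0 = g y + g (- y) + \<alpha> (- y\<^sup>2)"
    using g_add[of "x + y" "- y"] g_add[of y "- y"] g_zero by simp_all
  moreover have "g (x + y) = g x + g y + \<alpha> m" using g_add[of x y] m by simp
  ultimately have "g x + (g y + g (- y)) + (\<alpha> m + \<alpha> (- y\<^sup>2 - m))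
      = g x + (g y + g (- y)) + \<alpha> (- y\<^sup>2)"
    by (simp add: add_ac)
  then show ?thesis by (rule add_left_imp_eq)
qed

text \<open>\<open>\<alpha> (- u\<^sup>2)\<close> is minus twice the even part of \<open>g\<close>,
  and the pairs \<open>(x, y)\<close> and \<open>(- x, - y)\<close> have the same product. This
  later gives \<open>\<alpha> (- 4)\<close>.\<close>

lemma alpha_neg_square_sum:
  "\<alpha> (- (x + y)\<^sup>2) = \<alpha> (- x\<^sup>2) + \<alpha> (- y\<^sup>2) - 2 * \<alpha> (x * y)"
proof -
  have neg: "\<alpha> (- u\<^sup>2) = - g u - g (- u)" for u
    using g_add[of u "- u"] g_zero
    by (simp add: power2_eq_square eq_diff_eq eq_neg_iff_add_eq_0 add_ac)
  show ?thesis
    using g_add[of x y] g_add[of "- x" "- y"] by (simp add: neg algebra_simps)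
qed

text \<open>Oddness at 1 needs its own argument, since writing 1 or -1 as a difference of squares in
  \<open>alpha_uminus\<close> makes one of the squares 0. The detour goes through oddness at
  2.\<close>

lemma alpha_uminus_one: "\<alpha> (- 1) = - \<alpha> 1" if odd: "\<And>k. k \<noteq> 1 \<Longrightarrow> k \<noteq> - 1 \<Longrightarrow> \<alpha> (- k) = - \<alpha> k"
proof (cases "(3::'a) = 0")
  case True
  have "\<alpha> 1 + \<alpha> (- 2) = \<alpha> (- 1)" using alpha_add_neg_square[of 1 1] by simp
  \<comment> \<open>In characteristic 3, 2 equals -1, so \<open>odd\<close> says nothing about it;
    but \<open>\<alpha> (- 1) = 2 * \<alpha> 1\<close> and \<open>3 * \<alpha> 1 = 0\<close>
    suffice.\<close>
  moreover have "(- 2::'a) = 1" using True by (simp add: neg_eq_iff_add_eq_0)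
  moreover have "\<alpha> 1 + \<alpha> 1 + \<alpha> 1 = 3 * \<alpha> 1" by simp
  ultimately show ?thesis using True by (simp add: eq_neg_iff_add_eq_0)
next
  case False
  have "(2::'a) \<noteq> - 1" using False by (simp add: eq_neg_iff_add_eq_0)
  moreover have "(2::'a) \<noteq> 1" 
    by (simp only: one_add_one[symmetric] add_cancel_left_left one_neq_zero not_False_eq_True)
  ultimately have "\<alpha> (- 2) = - \<alpha> 2" by (intro odd)
  moreover have "\<alpha> (- 1) = \<alpha> 1 + \<alpha> (- 2)" using alpha_add_neg_square[of 1 1] by simp
  moreover have "\<alpha> 2 = 2 * \<alpha> 1"
  proof -
    \<comment> \<open>Two evaluations of \<open>\<alpha> (- 4)\<close> determine
      \<open>\<alpha> (- 3)\<close>, and the splitting of -1 as 2 + (-3) then yields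
      \<open>\<alpha> 2\<close>.\<close>
    have "\<alpha> (- 1) + \<alpha> (- 3) = \<alpha> (- 4)"
      using alpha_add_neg_square[of 2 "- 1"] two_nonzero by simp
    also have "\<dots> = 2 * \<alpha> (- 1) - 2 * \<alpha> 1" using alpha_neg_square_sum[of 1 1] by simp
    also have "\<dots> = \<alpha> (- 1) + (\<alpha> (- 1) - 2 * \<alpha> 1)" by (simp only: mult_2 add_diff_eq)
    finally have "\<alpha> (- 3) = \<alpha> (- 1) - 2 * \<alpha> 1" by (rule add_left_imp_eq)
    moreover have "\<alpha> 2 = \<alpha> (- 1) - \<alpha> (- 3)"
      using alpha_add_neg_square[of 1 2] by (simp add: eq_diff_eq)
    ultimately show ?thesis by simp
  qed
  ultimately show ?thesis by simp
qed

lemma alpha_uminus: "\<alpha> (- k) = - \<alpha> k"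
proof -
  have generic: "\<alpha> (- k) = - \<alpha> k" if k: "k \<noteq> 1" "k \<noteq> - 1" for k
  proof -
    \<comment> \<open>With \<open>k = s\<^sup>2 - r\<^sup>2\<close>, both
      \<open>k - s\<^sup>2 = - r\<^sup>2\<close> and \<open>- k - r\<^sup>2 = - s\<^sup>2\<close>
      are admissible splittings; adding the two relations cancels the squares. The excluded
      \<open>k\<close> are those with \<open>s = 0\<close> or \<open>r = 0\<close>.\<close>
    define s r where "s = (k + 1) / 2" and "r = (k - 1) / 2"
    have "s \<noteq> 0" "r \<noteq> 0"
      using k two_nonzero by (auto simp: s_def r_def eq_neg_iff_add_eq_0)
    moreover have "s\<^sup>2 - r\<^sup>2 = k"
      unfolding s_def r_def by (rule square_diff_representation[OF two_nonzero])
    then have "- s\<^sup>2 - - k = - r\<^sup>2" "- r\<^sup>2 - k = - s\<^sup>2" by (auto simp: algebra_simps)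
    ultimately have "\<alpha> k + \<alpha> (- s\<^sup>2) = \<alpha> (- r\<^sup>2)" "\<alpha> (- k) + \<alpha> (- r\<^sup>2) = \<alpha> (- s\<^sup>2)"
      using alpha_add_neg_square[of r k] alpha_add_neg_square[of s "- k"] by simp_all
    then have "\<alpha> (- k) + \<alpha> k + \<alpha> (- s\<^sup>2) = \<alpha> (- s\<^sup>2)" by (simp add: add.assoc)
    then show ?thesis by (simp add: eq_neg_iff_add_eq_0)
  qed
  have "\<alpha> (- 1) = - \<alpha> 1" by (rule alpha_uminus_one) (rule generic)
  then show ?thesis using generic[of k] by (cases "k = 1 \<or> k = - 1") auto
qed

lemma alpha_square_add: "\<alpha> (s\<^sup>2 + m) = \<alpha> (s\<^sup>2) + \<alpha> m"
proof (cases "s = 0")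
  case True
  then show ?thesis by (simp add: alpha_zero)
next
  case False
  have "\<alpha> (- s\<^sup>2 - m) = - \<alpha> (s\<^sup>2 + m)" using alpha_uminus[of "s\<^sup>2 + m"] by simp
  with alpha_add_neg_square[OF False, of m] alpha_uminus[of "s\<^sup>2"] show ?thesis
    by (simp add: diff_eq_eq)
qed

lemma additive_alpha: "additive \<alpha>"
proof
  fix u m :: 'a
  define s r where "s = (u + 1) / 2" and "r = (u - 1) / 2"
  have u: "u = s\<^sup>2 - r\<^sup>2"
    unfolding s_def r_def by (rule square_diff_representation[OF two_nonzero, symmetric])
  have diff: "\<alpha> (v - r\<^sup>2) = \<alpha> v - \<alpha> (r\<^sup>2)" for v
    using alpha_square_add[of r "v - r\<^sup>2"] by simp
  have "\<alpha> (u + m) = \<alpha> ((s\<^sup>2 + m) - r\<^sup>2)" by (simp add: u algebra_simps)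
  also have "\<dots> = (\<alpha> (s\<^sup>2) - \<alpha> (r\<^sup>2)) + \<alpha> m" by (simp add: diff alpha_square_add)
  also have "\<dots> = \<alpha> u + \<alpha> m" by (simp add: u diff)
  finally show "\<alpha> (u + m) = \<alpha> u + \<alpha> m" .
qed

text \<open>Once \<open>\<alpha>\<close> is additive, half of \<open>\<alpha> (x\<^sup>2)\<close>
  has the same Cauchy difference \<open>\<alpha> (x * y)\<close> as \<open>g\<close>.\<close>

lemma additive_remainder: "additive (\<lambda>x. g x - 1 / 2 * \<alpha> (x\<^sup>2))"
proof
  fix x y :: 'a
  have "(x + y)\<^sup>2 = x\<^sup>2 + (y\<^sup>2 + (x * y + x * y))" by (simp add: power2_eq_square algebra_simps)
  then have "\<alpha> ((x + y)\<^sup>2) = \<alpha> (x\<^sup>2) + \<alpha> (y\<^sup>2) + 2 * \<alpha> (x * y)"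
    by (simp only: additive.add[OF additive_alpha] mult_2 add.assoc)
  then show "g (x + y) - 1 / 2 * \<alpha> ((x + y)\<^sup>2)
      = (g x - 1 / 2 * \<alpha> (x\<^sup>2)) + (g y - 1 / 2 * \<alpha> (y\<^sup>2))"
    using two_nonzero by (simp add: g_add add_divide_distrib)
qed

end

theorem proposition3:
  fixes f \<alpha> :: "'a::field \<Rightarrow> 'a"
  assumes two_nonzero: "(2::'a) \<noteq> 0"
    and eq: "\<And>x y. f (x + y) - f x - f y = \<alpha> (x * y)"
  shows "\<exists>(\<gamma>::'a) (a::'a \<Rightarrow> 'a) (A::'a \<Rightarrow> 'a). additive a \<and> additive A \<and>
           (\<forall>x. \<alpha> x = a x + \<gamma> \<and> f x = 1 / 2 * a (x\<^sup>2) + A x - \<gamma>)"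
proof -
  \<comment> \<open>At \<open>x = y = 0\<close> the equation gives
    \<open>f 0 = - \<alpha> 0\<close>, so one constant normalizes both functions, entering
    \<open>f\<close> with a minus sign.\<close>
  define \<gamma> where "\<gamma> = \<alpha> 0"
  define a where "a = (\<lambda>x. \<alpha> x - \<gamma>)"
  define g where "g = (\<lambda>x. f x + \<gamma>)"
  interpret normalized_solution g a
  proof
    show "(2::'a) \<noteq> 0" by (rule two_nonzero)
    show "g (x + y) = g x + g y + a (x * y)" for x y
      using eq[of x y] by (simp add: g_def a_def algebra_simps)
    show "g 0 = 0" using eq[of 0 0] by (simp add: g_def \<gamma>_def flip: neg_eq_iff_add_eq_0)
  qed
  have "\<alpha> x = a x + \<gamma> \<and> f x = 1 / 2 * a (x\<^sup>2) + (g x - 1 / 2 * a (x\<^sup>2)) - \<gamma>" for x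
    by (simp add: a_def g_def)
  then show ?thesis using additive_alpha additive_remainder by blast
qed

end
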